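(* Let $K$ be a field. There exists a graded twisting map $\tau:K[y]\otimes K[x]\to K[x]\otimes K[y]$, with matrix $M$ satisfying $M_{1*}=(1,-1,1,0,0,\dots)$, such that $\widetilde{M}:=M-Y$ satisfies $\widetilde{M}_{k*}=\widetilde{M}_{0*}$ for all $k\in\mathbb{N}$.
   Context: $\mathbb{N}=\{1,2,\dots\}$, $\mathbb{N}_0=\mathbb{N}\cup\{0\}$. Tensor products are over $K$; $\mu_{K[x]},\mu_{K[y]}$ denote multiplication. $L(K^{\mathbb{N}_0})$ is the algebra of infinite matrices over $K$ indexed by $\mathbb{N}_0\times\mathbb{N}_0$ with finitely many nonzero entries in each row; $Y$ is the matrix with $Y_{ij}=\delta_{i+1,j}$; $A_{k*}$ is the $k$-th row of $A$. A twisting map is a $K$-linear map $\tau:K[y]\otimes K[x]\to K[x]\otimes K[y]$ such that $\tau(1\otimes f)=f\otimes 1$ and $\tau(y^r\otimes 1)=1\otimes y^r$ for all $f\in K[x]$, $r\ge 0$; $\tau\circ(\mathrm{id}_{K[y]}\otimes\mu_{K[x]})=(\mu_{K[x]}\otimes \mathrm{id}_{K[y]})\circ(\mathrm{id}_{K[x]}\otimes\tau)\circ(\tau\otimes \mathrm{id}_{K[x]})$; and $\tau\circ(\mu_{K[y]}\otimes\mathrm{id}_{K[x]})=(\mathrm{id}_{K[x]}\otimes\mu_{K[y]})\circ(\tau\otimes\mathrm{id}_{K[y]})\circ(\mathrm{id}_{K[y]}\otimes\tau)$. It is graded if $\tau(y^r\otimes x^i)$ lies in the span of $\{x^{r+i-j}\otimes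 y^j:0\le j\le r+i\}$ for all $r,i$. The matrix of a graded twisting map $\tau$ is the matrix $M\in L(K^{\mathbb{N}_0})$ with $\tau(y^k\otimes x)=\sum_{j=0}^{k+1}M_{kj}\,x^{k+1-j}\otimes y^j$ and $M_{kj}=0$ for $j>k+1$. A matrix $M\in L(K^{\mathbb{N}_0})$ is the matrix of a (unique) graded twisting map if and only if $M_{0j}=\delta_{0j}$, $M_{kj}=0$ for $j>k+1$, and $Y^kM=\sum_{j=0}^{k+1}M_{kj}M^{k+1-j}Y^j$ for all $k\in\mathbb{N}_0$. *)

theory Defs
  imports
    "HOL-Library.Poly_Mapping"
    "HOL-Computational_Algebra.Polynomial"
begin

section \<open>Vector spaces with a basis and their tensor products\<close>

text \<open>
  The type \<open>'a \<Rightarrow>\<^sub>0 'k\<close> of finitely supported functions is the \<open>'k\<close>-vector space with basis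
  \<open>single a 1\<close>, for \<open>a :: 'a\<close>. The tensor product of the spaces with bases \<open>'a\<close> and \<open>'b\<close> is
  realised as the space with basis \<open>'a \<times> 'b\<close>; \<open>tensor_lift\<close> and the lemmas about it
  provide its universal property.
\<close>

definition pscale :: "'k::field \<Rightarrow> ('a \<Rightarrow>\<^sub>0 'k) \<Rightarrow> ('a \<Rightarrow>\<^sub>0 'k)" where
  "pscale c f = Poly_Mapping.map ((*) c) f"

abbreviation klinear :: "(('a \<Rightarrow>\<^sub>0 'k::field) \<Rightarrow> ('b \<Rightarrow>\<^sub>0 'k)) \<Rightarrow> bool" where
  "klinear \<equiv> Vector_Spaces.linear pscale pscale"

definition kbilinear :: "(('a \<Rightarrow>\<^sub>0 'k::field) \<Rightarrow> ('b \<Rightarrow>\<^sub>0 'k) \<Rightarrow> ('c \<Rightarrow>\<^sub>0 'k)) \<Rightarrow> bool" where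
  "kbilinear B \<longleftrightarrow> (\<forall>g. klinear (\<lambda>f. B f g)) \<and> (\<forall>f. klinear (B f))"

lift_definition tensor ::
  "('a \<Rightarrow>\<^sub>0 'k::field) \<Rightarrow> ('b \<Rightarrow>\<^sub>0 'k) \<Rightarrow> ('a \<times> 'b \<Rightarrow>\<^sub>0 'k)" (infixl \<open>\<otimes>\<close> 70)
  is "\<lambda>f g (a, b). f a * g b"
proof -
  fix f :: "'a \<Rightarrow> 'k" and g :: "'b \<Rightarrow> 'k"
  assume "finite {a. f a \<noteq> 0}" and "finite {b. g b \<noteq> 0}"
  then have "finite ({a. f a \<noteq> 0} \<times> {b. g b \<noteq> 0})" by blast
  then show "finite {p. (case p of (a, b) \<Rightarrow> f a * g b) \<noteq> 0}"
    by (rule rev_finite_subset) auto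
qed

definition tensor_lift ::
  "(('a \<Rightarrow>\<^sub>0 'k::field) \<Rightarrow> ('b \<Rightarrow>\<^sub>0 'k) \<Rightarrow> ('c \<Rightarrow>\<^sub>0 'k)) \<Rightarrow> ('a \<times> 'b \<Rightarrow>\<^sub>0 'k) \<Rightarrow> ('c \<Rightarrow>\<^sub>0 'k)" where
  "tensor_lift B t =
     (\<Sum>(a, b)\<in>Poly_Mapping.keys t.
        pscale (Poly_Mapping.lookup t (a, b)) (B (Poly_Mapping.single a 1) (Poly_Mapping.single b 1)))"

definition tensor_map ::
  "(('a \<Rightarrow>\<^sub>0 'k::field) \<Rightarrow> ('c \<Rightarrow>\<^sub>0 'k)) \<Rightarrow> (('b \<Rightarrow>\<^sub>0 'k) \<Rightarrow> ('d \<Rightarrow>\<^sub>0 'k)) \<Rightarrow>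
   ('a \<times> 'b \<Rightarrow>\<^sub>0 'k) \<Rightarrow> ('c \<times> 'd \<Rightarrow>\<^sub>0 'k)" where
  "tensor_map F G = tensor_lift (\<lambda>f g. F f \<otimes> G g)"

definition tensor_assoc ::
  "(('a \<times> 'b) \<times> 'c \<Rightarrow>\<^sub>0 'k::field) \<Rightarrow> ('a \<times> ('b \<times> 'c) \<Rightarrow>\<^sub>0 'k)" where
  "tensor_assoc = tensor_lift (\<lambda>t h. tensor_lift (\<lambda>f g. f \<otimes> (g \<otimes> h)) t)"

definition tensor_assoc_inv ::
  "('a \<times> ('b \<times> 'c) \<Rightarrow>\<^sub>0 'k::field) \<Rightarrow> (('a \<times> 'b) \<times> 'c \<Rightarrow>\<^sub>0 'k)" where
  "tensor_assoc_inv = tensor_lift (\<lambda>f t. tensor_lift (\<lambda>g h. (f \<otimes> g) \<otimes> h) t)"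

lemma lookup_pscale [simp]: "Poly_Mapping.lookup (pscale c f) a = c * Poly_Mapping.lookup f a"
  by (simp add: pscale_def Poly_Mapping.map.rep_eq when_def)

lemma lookup_tensor [simp]:
  "Poly_Mapping.lookup (f \<otimes> g) (a, b) = Poly_Mapping.lookup f a * Poly_Mapping.lookup g b"
  by (simp add: tensor.rep_eq)

lemma vector_space_pscale: "vector_space (pscale :: 'k::field \<Rightarrow> ('a \<Rightarrow>\<^sub>0 'k) \<Rightarrow> _)"
  by unfold_locales
    (auto intro!: poly_mapping_eqI simp: lookup_add algebra_simps)

lemma klinear_iff:
  fixes F :: "('a \<Rightarrow>\<^sub>0 'k::field) \<Rightarrow> ('b \<Rightarrow>\<^sub>0 'k)"
  shows "klinear F \<longleftrightarrow> (\<forall>f g. F (f + g) = F f + F g) \<and> (\<forall>c f. F (pscale c f) = pscale c (F f))"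
  by (simp add: vector_space_pscale Vector_Spaces.linear_def module_hom_def module_hom_axioms_def
      module_iff_vector_space)

lemma klinear_sum:
  assumes "klinear F" shows "F (sum h A) = (\<Sum>a\<in>A. F (h a))"
proof -
  interpret Vector_Spaces.linear pscale pscale F by (rule assms)
  show ?thesis by (rule sum)
qed

lemmas pscale_add_left = vector_space.vector_space_assms(2)[OF vector_space_pscale]
  and pscale_add_right = vector_space.vector_space_assms(1)[OF vector_space_pscale]
  and pscale_pscale = vector_space.vector_space_assms(3)[OF vector_space_pscale]

lemma pscale_sum: "pscale c (sum h A) = (\<Sum>a\<in>A. pscale c (h a))"
  by (rule poly_mapping_eqI) (simp add: lookup_sum sum_distrib_left)

lemma tensor_add_left: "(f + f') \<otimes> g = f \<otimes> g + f' \<otimes> g"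
  and tensor_add_right: "f \<otimes> (g + g') = f \<otimes> g + f \<otimes> g'"
  and tensor_pscale_left: "pscale c f \<otimes> g = pscale c (f \<otimes> g)"
  and tensor_pscale_right: "f \<otimes> pscale c g = pscale c (f \<otimes> g)"
  by (auto intro!: poly_mapping_eqI simp: lookup_add algebra_simps)

lemmas tensor_simps = tensor_add_left tensor_add_right tensor_pscale_left tensor_pscale_right

lemma kbilinear_tensor: "kbilinear (\<otimes>)"
  by (simp add: kbilinear_def klinear_iff tensor_simps)

lemma basis_expansion:
  "f = (\<Sum>a\<in>Poly_Mapping.keys f. pscale (Poly_Mapping.lookup f a) (Poly_Mapping.single a 1))"
proof (rule poly_mapping_eqI)
  fix k
  show "Poly_Mapping.lookup f k = Poly_Mapping.lookup
    (\<Sum>a\<in>Poly_Mapping.keys f. pscale (Poly_Mapping.lookup f a) (Poly_Mapping.single a 1)) k"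
    by (simp add: lookup_sum lookup_single when_def if_distrib[of "(*) _"] in_keys_iff
        cong: if_cong)
qed

lemma tensor_lift_superset:
  assumes "finite S" "Poly_Mapping.keys t \<subseteq> S"
  shows "tensor_lift B t =
     (\<Sum>(a, b)\<in>S. pscale (Poly_Mapping.lookup t (a, b))
        (B (Poly_Mapping.single a 1) (Poly_Mapping.single b 1)))"
  unfolding tensor_lift_def
proof (rule sum.mono_neutral_left[OF assms], safe)
  fix a b
  assume "(a, b) \<notin> Poly_Mapping.keys t"
  then have "Poly_Mapping.lookup t (a, b) = 0" by (simp add: in_keys_iff)
  then show "pscale (Poly_Mapping.lookup t (a, b))
      (B (Poly_Mapping.single a 1) (Poly_Mapping.single b 1)) = 0"
    by (auto intro!: poly_mapping_eqI)
qed

lemma klinear_tensor_lift: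
  fixes B :: "('a \<Rightarrow>\<^sub>0 'k::field) \<Rightarrow> ('b \<Rightarrow>\<^sub>0 'k) \<Rightarrow> ('c \<Rightarrow>\<^sub>0 'k)"
  shows "klinear (tensor_lift B)"
  unfolding klinear_iff
proof (intro conjI allI)
  fix s t :: "'a \<times> 'b \<Rightarrow>\<^sub>0 'k"
  let ?S = "Poly_Mapping.keys s \<union> Poly_Mapping.keys t"
  have "Poly_Mapping.keys (s + t) \<subseteq> ?S" by (rule Poly_Mapping.keys_add)
  then show "tensor_lift B (s + t) = tensor_lift B s + tensor_lift B t"
    by (subst (1 2 3) tensor_lift_superset[of ?S])
      (simp_all add: sum.distrib[symmetric] lookup_add pscale_add_left case_prod_unfold)
next
  fix c and t :: "'a \<times> 'b \<Rightarrow>\<^sub>0 'k"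
  have "Poly_Mapping.keys (pscale c t) \<subseteq> Poly_Mapping.keys t" by (auto simp: in_keys_iff)
  then show "tensor_lift B (pscale c t) = pscale c (tensor_lift B t)"
    by (subst (1 2) tensor_lift_superset[of "Poly_Mapping.keys t"])
      (simp_all add: pscale_sum pscale_pscale case_prod_unfold)
qed

lemma tensor_lift_tensor:
  assumes "kbilinear B"
  shows "tensor_lift B (f \<otimes> g) = B f g"
proof -
  let ?F = "Poly_Mapping.keys f" and ?G = "Poly_Mapping.keys g"
  let ?s = "\<lambda>a. Poly_Mapping.single a 1"
  have l1: "klinear (\<lambda>f. B f g)" for g using assms by (simp add: kbilinear_def)
  have l2: "klinear (B f)" for f using assms by (simp add: kbilinear_def)
  have "B f g = B (\<Sum>a\<in>?F. pscale (Poly_Mapping.lookup f a) (?s a)) g"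
    using basis_expansion[of f] by simp
  also have "\<dots> = (\<Sum>a\<in>?F. pscale (Poly_Mapping.lookup f a) (B (?s a) g))"
    using l1 by (simp add: klinear_sum[OF l1] klinear_iff)
  also have "\<dots> = (\<Sum>a\<in>?F. pscale (Poly_Mapping.lookup f a)
      (B (?s a) (\<Sum>b\<in>?G. pscale (Poly_Mapping.lookup g b) (?s b))))"
    using basis_expansion[of g] by simp
  also have "\<dots> = (\<Sum>a\<in>?F. pscale (Poly_Mapping.lookup f a)
      (\<Sum>b\<in>?G. pscale (Poly_Mapping.lookup g b) (B (?s a) (?s b))))"
    using l2 by (simp add: klinear_sum[OF l2] klinear_iff)
  also have "\<dots> = (\<Sum>(a, b)\<in>?F \<times> ?G. pscale (Poly_Mapping.lookup (f \<otimes> g) (a, b)) (B (?s a) (?s b)))"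
    by (simp add: sum.cartesian_product[symmetric] pscale_sum pscale_pscale)
  also have "\<dots> = tensor_lift B (f \<otimes> g)"
    by (rule tensor_lift_superset[symmetric]) (auto simp: in_keys_iff)
  finally show ?thesis by simp
qed

lemma tensor_linear_unique:
  fixes F G :: "('a \<times> 'b \<Rightarrow>\<^sub>0 'k::field) \<Rightarrow> ('c \<Rightarrow>\<^sub>0 'k)"
  assumes "klinear F" "klinear G" "\<And>f g. F (f \<otimes> g) = G (f \<otimes> g)"
  shows "F = G"
proof
  fix t
  have s: "Poly_Mapping.single p 1 = Poly_Mapping.single (fst p) 1 \<otimes> Poly_Mapping.single (snd p) (1 :: 'k)"
    for p :: "'a \<times> 'b"
    by (cases p) (auto intro!: poly_mapping_eqI simp: lookup_single when_def)
  have e: "H t = (\<Sum>p\<in>Poly_Mapping.keys t. pscale (Poly_Mapping.lookup t p)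
      (H (Poly_Mapping.single p 1)))" if "klinear H" for H :: "('a \<times> 'b \<Rightarrow>\<^sub>0 'k) \<Rightarrow> ('c \<Rightarrow>\<^sub>0 'k)"
    using arg_cong[OF basis_expansion[of t], of H] that
    by (simp add: klinear_sum[OF that] klinear_iff)
  show "F t = G t"
    unfolding e[OF assms(1)] e[OF assms(2)] s by (simp add: assms(3))
qed

lemma tensor_map_tensor:
  assumes "klinear F" "klinear G"
  shows "tensor_map F G (f \<otimes> g) = F f \<otimes> G g"
  unfolding tensor_map_def
  by (rule tensor_lift_tensor)
    (use assms in \<open>simp add: kbilinear_def klinear_iff tensor_simps\<close>)

lemma tensor_assoc_tensor:
  fixes f :: "'a \<Rightarrow>\<^sub>0 'k::field" and g :: "'b \<Rightarrow>\<^sub>0 'k" and h :: "'c \<Rightarrow>\<^sub>0 'k"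
  shows "tensor_assoc ((f \<otimes> g) \<otimes> h) = f \<otimes> (g \<otimes> h)"
proof -
  have b: "kbilinear (\<lambda>f g. f \<otimes> (g \<otimes> h))" for h :: "'c \<Rightarrow>\<^sub>0 'k"
    by (simp add: kbilinear_def klinear_iff tensor_simps)
  have "klinear (\<lambda>h :: 'c \<Rightarrow>\<^sub>0 'k. tensor_lift (\<lambda>f g. f \<otimes> (g \<otimes> h)) t)"
    for t :: "'a \<times> 'b \<Rightarrow>\<^sub>0 'k"
    unfolding klinear_iff tensor_lift_def
    by (simp add: tensor_simps pscale_sum pscale_pscale pscale_add_right sum.distrib
        case_prod_unfold mult.commute)
  then have "kbilinear (\<lambda>(t :: 'a \<times> 'b \<Rightarrow>\<^sub>0 'k) (h :: 'c \<Rightarrow>\<^sub>0 'k). tensor_lift (\<lambda>f g. f \<otimes> (g \<otimes> h)) t)"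
    using klinear_tensor_lift by (auto simp: kbilinear_def)
  from tensor_lift_tensor[OF this] show ?thesis
    unfolding tensor_assoc_def by (simp add: tensor_lift_tensor[OF b])
qed

lemma tensor_assoc_inv_tensor:
  fixes f :: "'a \<Rightarrow>\<^sub>0 'k::field" and g :: "'b \<Rightarrow>\<^sub>0 'k" and h :: "'c \<Rightarrow>\<^sub>0 'k"
  shows "tensor_assoc_inv (f \<otimes> (g \<otimes> h)) = (f \<otimes> g) \<otimes> h"
proof -
  have b: "kbilinear (\<lambda>g h. (f \<otimes> g) \<otimes> h)" for f :: "'a \<Rightarrow>\<^sub>0 'k"
    by (simp add: kbilinear_def klinear_iff tensor_simps)
  have "klinear (\<lambda>f :: 'a \<Rightarrow>\<^sub>0 'k. tensor_lift (\<lambda>g h. (f \<otimes> g) \<otimes> h) t)"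
    for t :: "'b \<times> 'c \<Rightarrow>\<^sub>0 'k"
    unfolding klinear_iff tensor_lift_def
    by (simp add: tensor_simps pscale_sum pscale_pscale pscale_add_right sum.distrib
        case_prod_unfold mult.commute)
  then have "kbilinear (\<lambda>(f :: 'a \<Rightarrow>\<^sub>0 'k) (t :: 'b \<times> 'c \<Rightarrow>\<^sub>0 'k). tensor_lift (\<lambda>g h. (f \<otimes> g) \<otimes> h) t)"
    using klinear_tensor_lift by (auto simp: kbilinear_def)
  from tensor_lift_tensor[OF this] show ?thesis
    unfolding tensor_assoc_inv_def by (simp add: tensor_lift_tensor[OF b])
qed


section \<open>Polynomial rings\<close>

text \<open>
  \<open>nat \<Rightarrow>\<^sub>0 'k\<close> with its convolution product is the polynomial ring in one indeterminate, in a
  form to which the tensor product above applies; \<open>to_poly\<close> is the ring isomorphism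
  onto \<open>'k poly\<close>. The rings \<open>K[x]\<close> and \<open>K[y]\<close> are both represented by this type and are told
  apart by their position in a tensor product.
\<close>

type_synonym 'k upoly = "nat \<Rightarrow>\<^sub>0 'k"

type_synonym 'k upoly_tensor = "nat \<times> nat \<Rightarrow>\<^sub>0 'k"

definition indet :: "'k::field upoly" where
  "indet = Poly_Mapping.single 1 1"

abbreviation x_indet :: "'k::field upoly" where "x_indet \<equiv> indet"
abbreviation y_indet :: "'k::field upoly" where "y_indet \<equiv> indet"

definition upoly_mult :: "'k::field upoly_tensor \<Rightarrow> 'k upoly" where
  "upoly_mult = tensor_lift (*)"

lemma pscale_conv_mult: "pscale c f = Poly_Mapping.single 0 c * (f :: 'k::field upoly)"
  unfolding pscale_def by (rule mult_map_scale_conv_mult)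

lemma upoly_mult_tensor: "upoly_mult (f \<otimes> g) = f * g"
  unfolding upoly_mult_def
  by (rule tensor_lift_tensor)
    (simp add: kbilinear_def klinear_iff pscale_conv_mult algebra_simps)

lemma indet_power: "indet ^ n = Poly_Mapping.single n 1"
  by (induction n) (simp_all add: indet_def mult_single)

definition to_poly :: "'k::field upoly \<Rightarrow> 'k poly" where
  "to_poly f = (\<Sum>n\<in>Poly_Mapping.keys f. monom (Poly_Mapping.lookup f n) n)"

lemma coeff_to_poly: "coeff (to_poly f) n = Poly_Mapping.lookup f n"
  by (simp add: to_poly_def coeff_sum in_keys_iff)

lemma bij_to_poly: "bij (to_poly :: 'k::field upoly \<Rightarrow> 'k poly)"
proof (rule bijI)
  show "inj (to_poly :: 'k upoly \<Rightarrow> 'k poly)"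
    by (rule injI) (metis coeff_to_poly poly_mapping_eqI)
  show "surj (to_poly :: 'k upoly \<Rightarrow> 'k poly)"
  proof (rule surjI)
    fix p :: "'k poly"
    have "finite {n. coeff p n \<noteq> 0}" using MOST_coeff_eq_0[of p] by (simp add: MOST_iff_cofinite)
    then show "to_poly (Abs_poly_mapping (coeff p)) = p"
      by (intro poly_eqI) (simp add: coeff_to_poly)
  qed
qed

lemma to_poly_add: "to_poly (f + g) = to_poly f + to_poly g"
  by (rule poly_eqI) (simp add: coeff_to_poly lookup_add)

lemma to_poly_pscale: "to_poly (pscale c f) = smult c (to_poly f)"
  by (rule poly_eqI) (simp add: coeff_to_poly)

lemma to_poly_indet_power: "to_poly (indet ^ n) = monom 1 n"
  by (rule poly_eqI) (simp add: coeff_to_poly indet_power lookup_single when_def)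

lemma to_poly_mult:
  fixes f g :: "'k::field upoly"
  shows "to_poly (f * g) = to_poly f * to_poly g"
proof -
  have s: "to_poly (sum h A) = (\<Sum>a\<in>A. to_poly (h a))" if "finite A"
    for h :: "nat \<Rightarrow> 'k upoly" and A
    by (rule poly_eqI) (simp add: coeff_to_poly lookup_sum coeff_sum)
  have m: "to_poly (Poly_Mapping.single i (c::'k)) = monom c i" for i c
    by (rule poly_eqI) (simp add: coeff_to_poly lookup_single when_def)
  have e: "h = (\<Sum>i\<in>Poly_Mapping.keys h. Poly_Mapping.single i (Poly_Mapping.lookup h i))"
    for h :: "'k upoly"
    using basis_expansion[of h] by (simp add: pscale_def)
  have "to_poly (f * g) = to_poly
    ((\<Sum>i\<in>Poly_Mapping.keys f. Poly_Mapping.single i (Poly_Mapping.lookup f i)) *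
     (\<Sum>j\<in>Poly_Mapping.keys g. Poly_Mapping.single j (Poly_Mapping.lookup g j)))"
    using e[of f] e[of g] by simp
  also have "\<dots> = to_poly f * to_poly g"
    by (simp add: sum_product s mult_single m mult_monom to_poly_def[of f] to_poly_def[of g])
  finally show ?thesis .
qed


section \<open>Graded twisting maps and their matrices\<close>

text \<open>
  Throughout, \<open>\<tau>\<close> maps \<open>K[y] \<otimes> K[x]\<close> to \<open>K[x] \<otimes> K[y]\<close>; the associators identify the two
  bracketings of a threefold tensor product.
\<close>

definition twisting_map :: "('k::field upoly_tensor \<Rightarrow> 'k upoly_tensor) \<Rightarrow> bool" where
  "twisting_map \<tau> \<longleftrightarrow>
     klinear \<tau> \<and>
     (\<forall>f. \<tau> (1 \<otimes> f) = f \<otimes> 1) \<and>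
     (\<forall>r. \<tau> (y_indet ^ r \<otimes> 1) = 1 \<otimes> y_indet ^ r) \<and>
     \<tau> \<circ> tensor_map id upoly_mult =
       tensor_map upoly_mult id \<circ> tensor_assoc_inv \<circ> tensor_map id \<tau> \<circ>
       tensor_assoc \<circ> tensor_map \<tau> id \<circ> tensor_assoc_inv \<and>
     \<tau> \<circ> tensor_map upoly_mult id =
       tensor_map id upoly_mult \<circ> tensor_assoc \<circ> tensor_map \<tau> id \<circ>
       tensor_assoc_inv \<circ> tensor_map id \<tau> \<circ> tensor_assoc"

definition graded :: "('k::field upoly_tensor \<Rightarrow> 'k upoly_tensor) \<Rightarrow> bool" where
  "graded \<tau> \<longleftrightarrow>
     (\<forall>r i. \<tau> (y_indet ^ r \<otimes> x_indet ^ i) \<in>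
        module.span pscale {x_indet ^ (r + i - j) \<otimes> y_indet ^ j | j. j \<le> r + i})"

definition row_finite :: "(nat \<Rightarrow> nat \<Rightarrow> 'k::zero) \<Rightarrow> bool" where
  "row_finite A \<longleftrightarrow> (\<forall>i. finite {j. A i j \<noteq> 0})"

definition shift_matrix :: "nat \<Rightarrow> nat \<Rightarrow> 'k::zero_neq_one" where
  "shift_matrix i j = (if i + 1 = j then 1 else 0)"

definition is_matrix_of ::
  "(nat \<Rightarrow> nat \<Rightarrow> 'k) \<Rightarrow> ('k::field upoly_tensor \<Rightarrow> 'k upoly_tensor) \<Rightarrow> bool" where
  "is_matrix_of M \<tau> \<longleftrightarrow>
     row_finite M \<and>
     (\<forall>k. \<tau> (y_indet ^ k \<otimes> x_indet) =
        (\<Sum>j\<le>k + 1. pscale (M k j) (x_indet ^ (k + 1 - j) \<otimes> y_indet ^ j))) \<and>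
     (\<forall>k j. j > k + 1 \<longrightarrow> M k j = 0)"

end

theory Submission
  imports Defs
begin

text \<open>
  The prescribed rows force \<open>\<tau>(y\<^sup>k \<otimes> x) = x\<^sup>k\<^sup>+\<^sup>1 \<otimes> 1 - x\<^sup>k \<otimes> y + 1 \<otimes> y\<^sup>k\<^sup>+\<^sup>1\<close>. With \<open>z = x - y\<close> this
  says that \<open>y\<^sup>k z = x\<^sup>k z\<close> for all \<open>k\<close> in the algebra generated by \<open>x\<close> and \<open>y\<close>. Hence
  \<open>y x\<^sup>k z = y y\<^sup>k z = x\<^sup>k\<^sup>+\<^sup>1 z\<close>, so \<open>z x\<^sup>k z = 0\<close>, and the ideal generated by \<open>z\<close> has square zero.
  In particular \<open>(g(y) - g(x)) (f(x) - f(y)) = 0\<close> for all polynomials \<open>f\<close> and \<open>g\<close>, because both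
  factors lie in that ideal. Expanding this product yields
  \<open>g(y) f(x) = (g f)(x) - g(x) f(y) + (g f)(y)\<close>, which leaves only one candidate for \<open>\<tau>\<close>:
  \<open>\<tau>(g \<otimes> f) = g f \<otimes> 1 - g \<otimes> f + 1 \<otimes> g f\<close>.

  That this \<open>\<tau>\<close> is a twisting map can be checked on pure tensors: each of the two
  multiplicativity laws expands to seven terms, of which four cancel in pairs
  (\<open>twist_multiplicative_right\<close>, \<open>twist_multiplicative_left\<close>). The grading and the matrix are
  read off from the value on \<open>y\<^sup>r \<otimes> x\<^sup>i\<close>.
\<close>

section \<open>Linear maps on tensor products\<close>

lemma tensor_diff_left: "(f - f') \<otimes> g = f \<otimes> g - f' \<otimes> g"
  and tensor_diff_right: "f \<otimes> (g - g') = f \<otimes> g - f \<otimes> g'"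
  by (auto intro!: poly_mapping_eqI simp: lookup_minus left_diff_distrib right_diff_distrib)

lemma pscale_diff_right: "pscale c (f - g) = pscale c f - pscale c g"
  by (rule poly_mapping_eqI) (simp add: lookup_minus algebra_simps)

lemma klinear_add: "klinear F \<Longrightarrow> F (f + g) = F f + F g"
  by (simp add: klinear_iff)

lemma klinear_diff:
  assumes "klinear F" shows "F (f - g) = F f - F g"
  using klinear_add[OF assms, of "f - g" g] by (simp add: algebra_simps)

lemma klinear_id: "klinear id"
  by (simp add: klinear_iff)

lemma klinear_comp: "klinear F \<Longrightarrow> klinear G \<Longrightarrow> klinear (F \<circ> G)"
  by (simp add: klinear_iff)

lemma klinear_tensor_right: "klinear ((\<otimes>) f)"
  and klinear_tensor_left: "klinear (\<lambda>f. f \<otimes> g)"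
  by (simp_all add: klinear_iff tensor_simps)

lemma klinear_tensor_map: "klinear (tensor_map F G)"
  and klinear_tensor_assoc: "klinear tensor_assoc"
  and klinear_tensor_assoc_inv: "klinear tensor_assoc_inv"
  and klinear_upoly_mult: "klinear upoly_mult"
  by (simp_all add: tensor_map_def tensor_assoc_def tensor_assoc_inv_def upoly_mult_def
      klinear_tensor_lift)

lemmas klinear_intros = klinear_id klinear_comp klinear_tensor_map klinear_tensor_assoc
  klinear_tensor_assoc_inv klinear_upoly_mult

lemma tensor3_linear_unique_right:
  assumes "klinear F" "klinear G" "\<And>f g h. F (f \<otimes> (g \<otimes> h)) = G (f \<otimes> (g \<otimes> h))"
  shows "F = G"
proof (rule tensor_linear_unique[OF assms(1,2)])
  fix f t
  have "F \<circ> (\<otimes>) f = G \<circ> (\<otimes>) f"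
    by (rule tensor_linear_unique) (simp_all add: assms klinear_comp klinear_tensor_right)
  then show "F (f \<otimes> t) = G (f \<otimes> t)" by (simp add: fun_eq_iff)
qed

lemma tensor3_linear_unique_left:
  assumes "klinear F" "klinear G" "\<And>f g h. F ((f \<otimes> g) \<otimes> h) = G ((f \<otimes> g) \<otimes> h)"
  shows "F = G"
proof (rule tensor_linear_unique[OF assms(1,2)])
  fix t h
  have "F \<circ> (\<lambda>t. t \<otimes> h) = G \<circ> (\<lambda>t. t \<otimes> h)"
    by (rule tensor_linear_unique) (simp_all add: assms klinear_comp klinear_tensor_left)
  then show "F (t \<otimes> h) = G (t \<otimes> h)" by (simp add: fun_eq_iff)
qed


section \<open>The twisting map\<close>

definition twist :: "'k::field upoly_tensor \<Rightarrow> 'k upoly_tensor" where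
  "twist t = upoly_mult t \<otimes> 1 - t + 1 \<otimes> upoly_mult t"

lemma twist_tensor: "twist (g \<otimes> f) = (g * f) \<otimes> 1 - g \<otimes> f + 1 \<otimes> (g * f)"
  by (simp add: twist_def upoly_mult_tensor)

lemma klinear_twist: "klinear twist"
  by (simp add: klinear_iff twist_def klinear_upoly_mult[unfolded klinear_iff] tensor_simps
      pscale_add_right pscale_diff_right)

lemmas linear_expand =
  klinear_add[OF klinear_tensor_map] klinear_diff[OF klinear_tensor_map]
  klinear_add[OF klinear_tensor_assoc] klinear_diff[OF klinear_tensor_assoc]
  klinear_add[OF klinear_tensor_assoc_inv] klinear_diff[OF klinear_tensor_assoc_inv]
  tensor_add_left tensor_add_right tensor_diff_left tensor_diff_right
  tensor_map_tensor klinear_id klinear_twist klinear_upoly_mult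
  tensor_assoc_tensor tensor_assoc_inv_tensor upoly_mult_tensor twist_tensor

text \<open>
  Moving \<open>g(y)\<close> past \<open>f(x)\<close> and then past \<open>h(x)\<close> gives
  \<open>g f h \<otimes> 1 - (g f h \<otimes> 1 - g f \<otimes> h + g \<otimes> f h) + (g f h \<otimes> 1 - g f \<otimes> h + 1 \<otimes> g f h)\<close>;
  the terms \<open>g f \<otimes> h\<close> and two of the three terms \<open>g f h \<otimes> 1\<close> cancel.
\<close>

lemma twist_multiplicative_right:
  "twist \<circ> tensor_map id upoly_mult =
     tensor_map upoly_mult id \<circ> tensor_assoc_inv \<circ> tensor_map id twist \<circ>
     tensor_assoc \<circ> tensor_map twist id \<circ> tensor_assoc_inv"
  by (rule tensor3_linear_unique_right)
    (simp_all add: klinear_intros klinear_twist linear_expand mult.assoc)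

lemma twist_multiplicative_left:
  "twist \<circ> tensor_map upoly_mult id =
     tensor_map id upoly_mult \<circ> tensor_assoc \<circ> tensor_map twist id \<circ>
     tensor_assoc_inv \<circ> tensor_map id twist \<circ> tensor_assoc"
  by (rule tensor3_linear_unique_left)
    (simp_all add: klinear_intros klinear_twist linear_expand mult.assoc)

lemma twisting_map_twist: "twisting_map twist"
  unfolding twisting_map_def
  by (simp add: klinear_twist twist_multiplicative_right twist_multiplicative_left)
    (simp add: twist_tensor)

lemma graded_twist: "graded (twist :: 'k::field upoly_tensor \<Rightarrow> _)"
  unfolding graded_def
proof (intro allI)
  fix r i
  let ?B = "{indet ^ (r + i - j) \<otimes> indet ^ j | j. j \<le> r + i} :: 'k upoly_tensor set"
  interpret vector_space "pscale :: 'k \<Rightarrow> 'k upoly_tensor \<Rightarrow> _" by (rule vector_space_pscale)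
  have B: "indet ^ (r + i - j) \<otimes> indet ^ j \<in> span ?B" if "j \<le> r + i" for j
    using that by (intro span_base) blast
  have "twist (indet ^ r \<otimes> indet ^ i :: 'k upoly_tensor) =
    indet ^ (r + i) \<otimes> 1 - indet ^ r \<otimes> indet ^ i + 1 \<otimes> indet ^ (r + i)"
    by (simp add: twist_tensor power_add)
  also have "\<dots> \<in> span ?B"
    using B[of 0] B[of i] B[of "r + i"] by (intro span_add span_diff) simp_all
  finally show "twist (indet ^ r \<otimes> indet ^ i) \<in> span ?B" .
qed


section \<open>Its matrix\<close>

text \<open>
  Written as a sum so that coinciding positions add up: in row \<open>0\<close> the entries \<open>- 1\<close> and \<open>1\<close>
  at column \<open>1\<close> cancel, and the row is \<open>(1, 0, 0, \<dots>)\<close>, as for every twisting map.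
\<close>

definition twist_matrix :: "nat \<Rightarrow> nat \<Rightarrow> 'k::field" where
  "twist_matrix k j = of_bool (j = 0) - of_bool (j = 1) + of_bool (j = k + 1)"

lemma is_matrix_of_twist: "is_matrix_of twist_matrix (twist :: 'k::field upoly_tensor \<Rightarrow> _)"
  unfolding is_matrix_of_def
proof (intro conjI allI impI)
  have "{j. twist_matrix k j \<noteq> (0 :: 'k)} \<subseteq> {0, 1, k + 1}" for k
    by (auto simp: twist_matrix_def)
  then show "row_finite (twist_matrix :: nat \<Rightarrow> nat \<Rightarrow> 'k)"
    unfolding row_finite_def by (meson finite.emptyI finite.insertI finite_subset)
next
  fix k
  define v where "v j = (indet ^ (k + 1 - j) \<otimes> indet ^ j :: 'k upoly_tensor)" for j
  interpret vector_space "pscale :: 'k \<Rightarrow> 'k upoly_tensor \<Rightarrow> _" by (rule vector_space_pscale)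
  have pick: "(\<Sum>j\<le>k + 1. pscale (of_bool (j = m)) (v j)) = v m" if "m \<le> k + 1" for m
  proof -
    have "(\<Sum>j\<le>k + 1. pscale (of_bool (j = m)) (v j)) = (\<Sum>j\<le>k + 1. if j = m then v j else 0)"
      by (intro sum.cong) auto
    also have "\<dots> = v m" using that by simp
    finally show ?thesis .
  qed
  have "twist (indet ^ k \<otimes> indet) = v 0 - v 1 + v (k + 1)"
    by (simp add: twist_tensor v_def power_commutes)
  also have "\<dots> = (\<Sum>j\<le>k + 1. pscale (twist_matrix k j) (v j))"
    unfolding twist_matrix_def scale_left_distrib scale_left_diff_distrib
      sum.distrib sum_subtractf
    by (simp only: pick le_add2 le_refl zero_le)
  finally show "twist (indet ^ k \<otimes> indet :: 'k upoly_tensor) = (\<Sum>j\<le>k + 1. pscale (twist_matrix k j)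
      (indet ^ (k + 1 - j) \<otimes> indet ^ j))"
    unfolding v_def .
next
  fix k j :: nat
  assume "j > k + 1"
  then show "twist_matrix k j = (0 :: 'k)" by (simp add: twist_matrix_def)
qed

theorem proposition4p4:
  shows "\<exists>(\<tau> :: 'k::field upoly_tensor \<Rightarrow> 'k upoly_tensor) (M :: nat \<Rightarrow> nat \<Rightarrow> 'k).
    twisting_map \<tau> \<and> graded \<tau> \<and> is_matrix_of M \<tau> \<and>
    M 1 = (\<lambda>j. if j = 0 then 1 else if j = 1 then - 1 else if j = 2 then 1 else 0) \<and>
    (\<forall>k\<ge>1. (M - shift_matrix) k = (M - shift_matrix) 0)"
proof (intro exI conjI)
  show "twist_matrix 1 =
      (\<lambda>j. if j = 0 then 1 else if j = 1 then - 1 else if j = 2 then 1 else 0 :: 'k)"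
    by (auto simp: twist_matrix_def fun_eq_iff)
  show "\<forall>k\<ge>1. (twist_matrix - shift_matrix) k = ((twist_matrix - shift_matrix) 0 :: nat \<Rightarrow> 'k)"
    by (auto simp: twist_matrix_def shift_matrix_def fun_eq_iff)
qed (rule twisting_map_twist graded_twist is_matrix_of_twist)+

end
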